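(* Assume: (1) each $f_i$, $i=1,\dots,q$, is twice continuously differentiable and bounded from below; (2) there are constants $c_h,c_b>0$ with $\|\nabla^2 f_i(x)\|\le c_h$ for all $x\in\mathbb{R}^n$, $i=1,\dots,q$, and $\beta_k\le c_b$ for every $k$; (3) there are constants $L,c_a>0$ such that, at every iteration $k$, the approximate functions $\tilde F_i$, $i=1,\dots,q$, are continuously differentiable with $L$-Lipschitz continuous gradients and $\|\nabla \tilde F_i(X_k)-G_i(X_k)\|\le c_a\Delta_k$. Suppose $v\in\Omega$ is such that, for all $i=1,\dots,q$, $\tilde m_{k,i}=\tilde M_{k,i}(v)$ is a $(c_f,c_g)$ fully linear model of $f_i$ on $B(x_k,\delta_k)$, where $x_k=X_k(v)$ and $\delta_k=\Delta_k(v)$. Let $c_e=c_f+L+c_g+c_a+c_h/2$ and $c_{\tilde\Phi}=\max\{c_f,c_e\}$. Then for all $d_k\in B(0,\delta_k)$: $$|\phi(x_k+d_k)-\tilde m_k(d_k)|\le c_f\delta_k^2,$$ $$|\tilde\phi(x_k+d_k)-\phi(x_k+d_k)|\le c_e\delta_k^2,$$ $$|\tilde\phi(x_k+d_k)-\tilde m_k(d_k)|\le c_{\tilde\Phi}\delta_k^2.$$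
   Context: $f=(f_1,\dots,f_q)^T:\mathbb{R}^n\to\mathbb{R}^q$; $\phi(x)=\max_i f_i(x)$; $\|\cdot\|$ is the Euclidean (resp. induced matrix) norm; $B(x,\delta)$ is the closed ball. A trust region algorithm generates random iterates $X_k\in\mathbb{R}^n$ and radii $\Delta_k>0$ on a probability space $(\Omega,\mathcal F,P)$. At iteration $k$ it randomly chooses approximate functions $\tilde F_i$, vectors $G_i(X_k)\in\mathbb{R}^n$ (approximate gradients) and matrices $H^i_k\in\mathbb{R}^{n\times n}$ (approximate Hessians), $i=1,\dots,q$, whose realizations at $v\in\Omega$ are denoted $\tilde f_i,g_i(x_k),H_k^i$. The models are $\tilde m_{k,i}(d)=\tilde f_i(x_k)+\langle g_i(x_k),d\rangle+\frac12\langle d,H^i_kd\rangle$ and $\tilde m_k(d)=\max_i\tilde m_{k,i}(d)$; $\tilde M_{k,i}$ denotes the random model with realization $\tilde m_{k,i}$. Further $\tilde\phi(x)=\max_i\tilde f_i(x)$ and $\beta_k=1+\max_i\|H^i_k\|$. Fully linear: for fixed $c_f,c_g>0$, a model $m$ is a $(c_f,c_g)$ fully linear model of $h$ on $B(x_k,\delta_k)$ if for all $d\in B(0,\delta_k)$: $|h(x_k+d)-m(d)|\le c_f\delta_k^2$ and $\|\nabla h(x_k+d)-\nabla m(d)\|\le c_g\delta_k$. *)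

theory Defs
  imports "HOL-Analysis.Analysis" "HOL-Probability.Probability"
begin

definition gradient :: "('a::euclidean_space \<Rightarrow> real) \<Rightarrow> 'a \<Rightarrow> 'a"
  where "gradient h x = (THE D. GDERIV h x :> D)"

lemma gradient_eqI:
  fixes h :: "'a::euclidean_space \<Rightarrow> real"
  assumes "GDERIV h x :> D"
  shows "gradient h x = D"
  unfolding gradient_def
proof (rule the_equality)
  fix E assume "GDERIV h x :> E"
  with assms have "(\<lambda>y. y \<bullet> E) = (\<lambda>y. y \<bullet> D)"
    unfolding gderiv_def by (rule has_derivative_unique[rotated])
  then have "y \<bullet> E = y \<bullet> D" for y
    by meson
  then show "E = D"
    using vector_eq_ldot by blast
qed (fact assms)

lemma GDERIV_gradient:
  fixes h :: "'a::euclidean_space \<Rightarrow> real"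
  assumes "h differentiable (at x)"
  shows "GDERIV h x :> gradient h x"
proof -
  obtain h' where h': "(h has_derivative h') (at x)"
    using assms by (auto simp: differentiable_def)
  then have "linear h'"
    by (rule has_derivative_linear)
  then have "h' = (\<lambda>y. y \<bullet> adjoint h' 1)"
    by (simp add: adjoint_works fun_eq_iff)
  with h' have "GDERIV h x :> adjoint h' 1"
    by (simp add: gderiv_def)
  then show ?thesis
    using gradient_eqI by metis
qed

definition hessian :: "(real ^ 'n \<Rightarrow> real) \<Rightarrow> real ^ 'n \<Rightarrow> real ^ 'n ^ 'n"
  where "hessian h x = jacobian (gradient h) (at x)"

definition C1_fun :: "(real ^ 'n \<Rightarrow> real) \<Rightarrow> bool"
  where "C1_fun h \<longleftrightarrow> h differentiable_on UNIV \<and> continuous_on UNIV (gradient h)"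

definition C2_fun :: "(real ^ 'n \<Rightarrow> real) \<Rightarrow> bool"
  where "C2_fun h \<longleftrightarrow>
    h differentiable_on UNIV \<and> gradient h differentiable_on UNIV \<and> continuous_on UNIV (hessian h)"

text \<open>The norm of the type \<open>real ^ 'n ^ 'n\<close> is the Frobenius norm, so the matrix norm induced
  by the Euclidean norm is expressed through the operator norm of the associated linear map.\<close>

definition mat_norm :: "real ^ 'n ^ 'm \<Rightarrow> real"
  where "mat_norm A = onorm ((*v) A)"

text \<open>A vector-valued function with \<open>q\<close> components is represented as a family indexed by a
  finite type.\<close>

definition max_fun :: "('q::finite \<Rightarrow> 'a \<Rightarrow> real) \<Rightarrow> 'a \<Rightarrow> real"
  where "max_fun h x = Max (range (\<lambda>i. h i x))"

definition quad_model ::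
  "(real ^ 'n \<Rightarrow> real) \<Rightarrow> real ^ 'n \<Rightarrow> real ^ 'n ^ 'n \<Rightarrow> real ^ 'n \<Rightarrow> real ^ 'n \<Rightarrow> real"
  where "quad_model h g B x d = h x + g \<bullet> d + 1 / 2 * (d \<bullet> (B *v d))"

definition hess_bound :: "('q::finite \<Rightarrow> real ^ 'n ^ 'n) \<Rightarrow> real"
  where "hess_bound B = 1 + Max (range (\<lambda>i. mat_norm (B i)))"

definition fully_linear ::
  "real \<Rightarrow> real \<Rightarrow> (real ^ 'n \<Rightarrow> real) \<Rightarrow> (real ^ 'n \<Rightarrow> real) \<Rightarrow> real ^ 'n \<Rightarrow> real \<Rightarrow> bool"
  where "fully_linear c\<^sub>f c\<^sub>g m h x \<delta> \<longleftrightarrow>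
    (\<forall>d \<in> cball 0 \<delta>.
      \<bar>h (x + d) - m d\<bar> \<le> c\<^sub>f * \<delta>\<^sup>2 \<and>
      norm (gradient h (x + d) - gradient m d) \<le> c\<^sub>g * \<delta>)"

text \<open>The random data of iteration \<open>k\<close>, as functions of the outcome: iterate \<open>X k\<close>, radius
  \<open>\<Delta> k\<close>, approximate functions \<open>F k i\<close>, approximate gradients \<open>G k i\<close> (standing for
  \<open>G\<^sub>i(X\<^sub>k)\<close>) and approximate Hessians \<open>H k i\<close>.  A random function is a family of functions
  whose value at every fixed point is a random variable.\<close>

definition trust_region_data ::
  "'w measure \<Rightarrow> (nat \<Rightarrow> 'w \<Rightarrow> real ^ 'n) \<Rightarrow> (nat \<Rightarrow> 'w \<Rightarrow> real) \<Rightarrow>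
   (nat \<Rightarrow> 'q::finite \<Rightarrow> 'w \<Rightarrow> real ^ 'n \<Rightarrow> real) \<Rightarrow> (nat \<Rightarrow> 'q \<Rightarrow> 'w \<Rightarrow> real ^ 'n) \<Rightarrow>
   (nat \<Rightarrow> 'q \<Rightarrow> 'w \<Rightarrow> real ^ 'n ^ 'n) \<Rightarrow> bool"
  where "trust_region_data M X \<Delta> F G H \<longleftrightarrow>
    prob_space M \<and>
    (\<forall>k. X k \<in> borel_measurable M) \<and>
    (\<forall>k. \<Delta> k \<in> borel_measurable M) \<and> (\<forall>k. \<forall>\<omega> \<in> space M. \<Delta> k \<omega> > 0) \<and>
    (\<forall>k i x. (\<lambda>\<omega>. F k i \<omega> x) \<in> borel_measurable M) \<and>
    (\<forall>k i. G k i \<in> borel_measurable M) \<and>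
    (\<forall>k i. H k i \<in> borel_measurable M)"

definition random_model ::
  "(nat \<Rightarrow> 'w \<Rightarrow> real ^ 'n) \<Rightarrow> (nat \<Rightarrow> 'q \<Rightarrow> 'w \<Rightarrow> real ^ 'n \<Rightarrow> real) \<Rightarrow>
   (nat \<Rightarrow> 'q \<Rightarrow> 'w \<Rightarrow> real ^ 'n) \<Rightarrow> (nat \<Rightarrow> 'q \<Rightarrow> 'w \<Rightarrow> real ^ 'n ^ 'n) \<Rightarrow>
   nat \<Rightarrow> 'q \<Rightarrow> 'w \<Rightarrow> real ^ 'n \<Rightarrow> real"
  where "random_model X F G H k i \<omega> = quad_model (F k i \<omega>) (G k i \<omega>) (H k i \<omega>) (X k \<omega>)"

end

theory Submission
  imports Defs
begin

text \<open>The gradients of \<open>f\<^sub>i\<close> and of the approximate functions are Lipschitz, so both functions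
  agree with their first-order expansions at \<open>x\<^sub>k\<close> up to a quadratic error. The approximate
  functions and the models share the value at \<open>x\<^sub>k\<close>, which full linearity compares
  with \<open>f\<^sub>i(x\<^sub>k)\<close>. The curvature of the model is controlled through full
  linearity: \<open>\<langle>d, H d\<rangle> = \<langle>d, \<nabla>m(d) - \<nabla>m(0)\<rangle>\<close>, and \<open>\<nabla>m\<close> differs from the
  \<open>c\<^sub>h\<close>-Lipschitz map \<open>\<nabla>f\<^sub>i\<close> by at most \<open>c\<^sub>g \<delta>\<^sub>k\<close>. All bounds pass to maxima.\<close>

text \<open>Each \<open>f i x\<close> is at most \<open>g i y + c\<close>, hence at most
  \<open>max_fun g y + c\<close>, and symmetrically. The points \<open>x\<close> and
  \<open>y\<close> are kept separate because functions evaluated at the trial point are compared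
  with models evaluated at the step.\<close>

lemma max_fun_diff_le:
  fixes f :: "'q::finite \<Rightarrow> 'a \<Rightarrow> real" and g :: "'q \<Rightarrow> 'b \<Rightarrow> real"
  assumes "\<And>i. \<bar>f i x - g i y\<bar> \<le> c"
  shows "\<bar>max_fun f x - max_fun g y\<bar> \<le> c"
proof -
  have "f i x \<le> max_fun g y + c" "g i y \<le> max_fun f x + c" for i
  proof -
    have "f i x \<le> max_fun f x" "g i y \<le> max_fun g y"
      unfolding max_fun_def by (auto intro: Max_ge)
    with assms[of i] show "f i x \<le> max_fun g y + c" "g i y \<le> max_fun f x + c"
      by linarith+
  qed
  then have "max_fun f x \<le> max_fun g y + c" "max_fun g y \<le> max_fun f x + c"
    by (auto simp: max_fun_def[of f x] max_fun_def[of g y])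
  then show ?thesis
    by linarith
qed

text \<open>Monotonicity along the segment from \<open>x\<close> to \<open>x + d\<close> replaces an
  integral remainder and still gives the factor 1/2. Only one side is proved here; the other follows
  by passing to \<open>- h\<close>.\<close>

lemma first_order_expansion_upper:
  fixes h :: "'a::euclidean_space \<Rightarrow> real"
  assumes h: "\<And>y. GDERIV h y :> D y" and lip: "L-lipschitz_on UNIV D"
  shows "h (x + d) - h x - D x \<bullet> d \<le> L / 2 * (norm d)\<^sup>2"
proof -
  \<comment> \<open>The expansion error along the segment minus its claimed bound. Since
    \<open>p 0 = h x\<close>, the claim is exactly \<open>p 1 \<le> p 0\<close>, so a nonpositive
    derivative on [0, 1] suffices.\<close>
  define p where "p t = h (x + t *\<^sub>R d) - t * (D x \<bullet> d) - L / 2 * t\<^sup>2 * (norm d)\<^sup>2" for t :: real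
  have deriv: "(p has_real_derivative
      (D (x + t *\<^sub>R d) - D x) \<bullet> d - L * t * (norm d)\<^sup>2) (at t)" for t
  proof -
    have "((\<lambda>s. h (x + s *\<^sub>R d)) has_derivative (\<lambda>s. (s *\<^sub>R d) \<bullet> D (x + t *\<^sub>R d))) (at t)"
      by (rule has_derivative_compose[of "\<lambda>s. x + s *\<^sub>R d"])
        (use h[of "x + t *\<^sub>R d"] in \<open>auto simp: gderiv_def intro!: derivative_eq_intros\<close>)
    then have "((\<lambda>s. h (x + s *\<^sub>R d)) has_real_derivative D (x + t *\<^sub>R d) \<bullet> d) (at t)"
      by (simp add: has_field_derivative_def inner_commute mult_commute_abs)
    then show ?thesis
      unfolding p_def by (auto intro!: derivative_eq_intros simp: inner_diff_left)
  qed
  have "p 1 \<le> p 0"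
  proof (rule DERIV_nonpos_imp_nonincreasing[where f = p and a = 0 and b = 1])
    fix t :: real assume t: "0 \<le> t"
    have "(D (x + t *\<^sub>R d) - D x) \<bullet> d \<le> norm (D (x + t *\<^sub>R d) - D x) * norm d"
      by (rule norm_cauchy_schwarz)
    also have "\<dots> \<le> (L * norm (t *\<^sub>R d)) * norm d"
      using lipschitz_onD[OF lip, of "x + t *\<^sub>R d" x]
      by (intro mult_right_mono) (auto simp: dist_norm)
    also have "\<dots> = L * t * (norm d)\<^sup>2"
      using t by (simp add: power2_eq_square)
    finally show "\<exists>y. (p has_real_derivative y) (at t) \<and> y \<le> 0"
      using deriv[of t] by fastforce
  qed simp
  then show ?thesis
    by (simp add: p_def)
qed

lemma first_order_expansion:
  fixes h :: "'a::euclidean_space \<Rightarrow> real"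
  assumes h: "h differentiable_on UNIV" and lip: "L-lipschitz_on UNIV (gradient h)"
  shows "\<bar>h (x + d) - h x - gradient h x \<bullet> d\<bar> \<le> L / 2 * (norm d)\<^sup>2"
proof -
  have D: "GDERIV h y :> gradient h y" for y
    using h by (auto simp: differentiable_on_def intro: GDERIV_gradient)
  then have D': "GDERIV (\<lambda>y. - h y) y :> - gradient h y" for y
    using GDERIV_minus by blast
  have lip': "L-lipschitz_on UNIV (\<lambda>y. - gradient h y)"
    using lip by (simp add: lipschitz_on_def dist_minus)
  show ?thesis
    using first_order_expansion_upper[OF D lip, of x d]
      first_order_expansion_upper[OF D' lip', of x d]
    by (auto simp: abs_if)
qed

text \<open>The mean value inequality for the gradient map, whose derivative is multiplication by
  the Hessian. It bounds by the operator norm, which is what \<open>mat_norm\<close> is.\<close>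

lemma C2_fun_gradient_lipschitz:
  assumes "C2_fun h" and bound: "\<And>x. mat_norm (hessian h x) \<le> C"
  shows "C-lipschitz_on UNIV (gradient h)"
proof (rule lipschitz_onI)
  have "(gradient h has_derivative (*v) (hessian h x)) (at x)" for x
    using assms(1) by (auto simp: C2_fun_def hessian_def differentiable_on_def jacobian_works)
  then have "norm (gradient h x - gradient h y) \<le> C * norm (x - y)" for x y
    by (intro differentiable_bound[of UNIV]) (use bound in \<open>auto simp: mat_norm_def\<close>)
  then show "dist (gradient h x) (gradient h y) \<le> C * dist x y" for x y
    by (simp add: dist_norm)
  have "0 \<le> mat_norm (hessian h 0)"
    unfolding mat_norm_def by (rule onorm_pos_le) (rule matrix_vector_mul_bounded_linear)
  then show "0 \<le> C"
    using bound[of 0] by linarith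
qed

text \<open>The matrix \<open>B\<close> is not assumed symmetric, so its symmetric part
  appears.\<close>

lemma gradient_quad_model:
  "gradient (quad_model h g B x) d = g + (1/2) *\<^sub>R (B *v d + transpose B *v d)"
proof (rule gradient_eqI)
  have "((\<lambda>d. h x + g \<bullet> d + 1 / 2 * (d \<bullet> (B *v d))) has_derivative
      (\<lambda>e. g \<bullet> e + 1 / 2 * (d \<bullet> (B *v e) + e \<bullet> (B *v d)))) (at d)"
    by (auto intro!: derivative_eq_intros
        bounded_linear.has_derivative[OF matrix_vector_mul_bounded_linear])
  moreover have "d \<bullet> (B *v e) = e \<bullet> (transpose B *v d)" for e
    by (metis dot_lmul_matrix inner_commute transpose_matrix_vector)
  moreover have "g \<bullet> e = e \<bullet> g" for e
    by (rule inner_commute)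
  ultimately show "GDERIV (quad_model h g B x) d :> g + (1/2) *\<^sub>R (B *v d + transpose B *v d)"
    by (simp add: gderiv_def quad_model_def[abs_def] inner_add_right add.commute)
qed

text \<open>The antisymmetric part of \<open>B\<close> contributes nothing to the quadratic form, so
  the gradient difference recovers it for arbitrary \<open>B\<close>.\<close>

lemma quad_model_curvature:
  "d \<bullet> (B *v d) = (gradient (quad_model h g B x) d - gradient (quad_model h g B x) 0) \<bullet> d"
proof -
  have "(transpose B *v d) \<bullet> d = d \<bullet> (B *v d)"
    by (metis dot_lmul_matrix transpose_matrix_vector)
  then show ?thesis
    by (simp add: gradient_quad_model inner_add_left inner_add_right inner_commute)
qed

text \<open>The constant collects two model gradient errors, at \<open>d\<close> and at 0, and the
  variation of the gradient of \<open>f\<close> between \<open>x\<close> and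
  \<open>x + d\<close>.\<close>

lemma fully_linear_curvature:
  assumes "fully_linear c\<^sub>f c\<^sub>g (quad_model F g B x) f x \<delta>"
    and lip: "c\<^sub>h-lipschitz_on UNIV (gradient f)" and d: "norm d \<le> \<delta>"
  shows "\<bar>d \<bullet> (B *v d)\<bar> \<le> (2 * c\<^sub>g + c\<^sub>h) * \<delta>\<^sup>2"
proof -
  let ?m = "gradient (quad_model F g B x)" and ?f = "gradient f"
  have \<delta>: "0 \<le> \<delta>"
    using d norm_ge_zero[of d] by linarith
  have "norm (?f (x + d) - ?m d) \<le> c\<^sub>g * \<delta>" "norm (?f (x + 0) - ?m 0) \<le> c\<^sub>g * \<delta>"
    using assms(1) d \<delta> unfolding fully_linear_def by (auto simp del: add_0_right)
  moreover have "norm (?f (x + d) - ?f x) \<le> c\<^sub>h * \<delta>"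
    using lipschitz_onD[OF lip, of "x + d" x] mult_left_mono[OF d lipschitz_on_nonneg[OF lip]]
    by (simp add: dist_norm)
  \<comment> \<open>Triangle inequality for the splitting of \<open>?m d - ?m 0\<close> into
    \<open>(?f x - ?m 0) - (?f (x + d) - ?m d)\<close> plus
    \<open>?f (x + d) - ?f x\<close>.\<close>
  moreover have "norm (?m d - ?m 0) \<le> norm (?f (x + 0) - ?m 0) + norm (?f (x + d) - ?m d)
      + norm (?f (x + d) - ?f x)"
    using norm_triangle_ineq[of "?f (x + 0) - ?m 0 - (?f (x + d) - ?m d)" "?f (x + d) - ?f x"]
      norm_triangle_ineq4[of "?f (x + 0) - ?m 0" "?f (x + d) - ?m d"] by simp
  ultimately have *: "norm (?m d - ?m 0) \<le> (2 * c\<^sub>g + c\<^sub>h) * \<delta>"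
    by (simp add: algebra_simps)
  have "\<bar>(?m d - ?m 0) \<bullet> d\<bar> \<le> norm (?m d - ?m 0) * norm d"
    by (rule Cauchy_Schwarz_ineq2)
  also have "\<dots> \<le> ((2 * c\<^sub>g + c\<^sub>h) * \<delta>) * \<delta>"
    \<comment> \<open>No sign of \<open>c\<^sub>g\<close> is assumed; nonnegativity of the bound is
      read off from \<open>*\<close>.\<close>
    using * d order_trans[OF norm_ge_zero *] by (intro mult_mono) auto
  finally show ?thesis
    by (simp add: power2_eq_square quad_model_curvature[of d B F g x] mult.assoc)
qed

text \<open>Replacing the exact gradient by \<open>g\<close> costs at most
  \<open>c * \<delta>\<close> times \<open>norm d\<close>. It serves both the approximate function,
  with \<open>c\<^sub>a\<close>, and \<open>f\<close> itself, with \<open>c\<^sub>g\<close>.\<close>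

lemma approx_gradient_expansion:
  fixes F :: "'a::euclidean_space \<Rightarrow> real"
  assumes "F differentiable_on UNIV" and lip: "L-lipschitz_on UNIV (gradient F)"
    and g: "norm (gradient F x - g) \<le> c * \<delta>" and d: "norm d \<le> \<delta>"
  shows "\<bar>F (x + d) - F x - g \<bullet> d\<bar> \<le> (L / 2 + c) * \<delta>\<^sup>2"
proof -
  have "\<bar>(gradient F x - g) \<bullet> d\<bar> \<le> norm (gradient F x - g) * norm d"
    by (rule Cauchy_Schwarz_ineq2)
  also have "\<dots> \<le> (c * \<delta>) * \<delta>"
    using g d order_trans[OF norm_ge_zero g] by (intro mult_mono) auto
  finally have "\<bar>gradient F x \<bullet> d - g \<bullet> d\<bar> \<le> c * \<delta>\<^sup>2"
    by (simp add: inner_diff_left power2_eq_square mult.assoc)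
  moreover have "L / 2 * (norm d)\<^sup>2 \<le> L / 2 * \<delta>\<^sup>2"
    using d lipschitz_on_nonneg[OF lip] by (intro mult_left_mono power_mono) auto
  ultimately show ?thesis
    using first_order_expansion[OF assms(1) lip, of x d] unfolding distrib_right by linarith
qed

text \<open>The vector \<open>g\<close> approximates the gradients of both \<open>F\<close> and
  \<open>f\<close> at \<open>x\<close>, so the two linear expansions have the same slope and
  subtracting them leaves the gap \<open>f x - F x\<close>, of size
  \<open>c\<^sub>f * \<delta>\<^sup>2\<close>. The second bound has no \<open>c\<^sub>f\<close>
  because \<open>F\<close> and the model agree at \<open>x\<close>.\<close>

lemma fully_linear_component_bounds:
  fixes f F :: "real ^ 'n \<Rightarrow> real"
  assumes F: "F differentiable_on UNIV" "L-lipschitz_on UNIV (gradient F)"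
    and f: "f differentiable_on UNIV" "c\<^sub>h-lipschitz_on UNIV (gradient f)"
    and g: "norm (gradient F x - g) \<le> c\<^sub>a * \<delta>"
    and fl: "fully_linear c\<^sub>f c\<^sub>g (quad_model F g B x) f x \<delta>"
    and d: "norm d \<le> \<delta>"
  shows "\<bar>F (x + d) - f (x + d)\<bar> \<le> (c\<^sub>f + L / 2 + c\<^sub>g + c\<^sub>a + c\<^sub>h / 2) * \<delta>\<^sup>2"
    and "\<bar>F (x + d) - quad_model F g B x d\<bar> \<le> (L / 2 + c\<^sub>g + c\<^sub>a + c\<^sub>h / 2) * \<delta>\<^sup>2"
proof -
  have \<delta>: "0 \<le> \<delta>"
    using d norm_ge_zero[of d] by linarith
  note FE = approx_gradient_expansion[OF F g d]
  show "\<bar>F (x + d) - quad_model F g B x d\<bar> \<le> (L / 2 + c\<^sub>g + c\<^sub>a + c\<^sub>h / 2) * \<delta>\<^sup>2"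
    \<comment> \<open>The factor 1/2 of the quadratic term turns
      \<open>2 * c\<^sub>g + c\<^sub>h\<close> into
      \<open>c\<^sub>g + c\<^sub>h / 2\<close>.\<close>
    using FE fully_linear_curvature[OF fl f(2) d]
    by (simp add: quad_model_def distrib_right)
  have "0 \<in> cball (0 :: real ^ 'n) \<delta>"
    using \<delta> by simp
  with fl have "\<bar>f (x + 0) - quad_model F g B x 0\<bar> \<le> c\<^sub>f * \<delta>\<^sup>2"
    and "norm (gradient f (x + 0) - gradient (quad_model F g B x) 0) \<le> c\<^sub>g * \<delta>"
    unfolding fully_linear_def by blast+
  \<comment> \<open>At the zero step the model has value \<open>F x\<close> and gradient
    \<open>g\<close>.\<close>
  then have "\<bar>f x - F x\<bar> \<le> c\<^sub>f * \<delta>\<^sup>2" and "norm (gradient f x - g) \<le> c\<^sub>g * \<delta>"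
    by (simp_all add: quad_model_def gradient_quad_model)
  with FE approx_gradient_expansion[OF f _ d, of x g c\<^sub>g]
  show "\<bar>F (x + d) - f (x + d)\<bar> \<le> (c\<^sub>f + L / 2 + c\<^sub>g + c\<^sub>a + c\<^sub>h / 2) * \<delta>\<^sup>2"
    by (simp add: distrib_right)
qed

theorem lemma5:
  fixes f :: "'q::finite \<Rightarrow> real ^ 'n \<Rightarrow> real"
    and M :: "'w measure"
    and X :: "nat \<Rightarrow> 'w \<Rightarrow> real ^ 'n"
    and \<Delta> :: "nat \<Rightarrow> 'w \<Rightarrow> real"
    and F :: "nat \<Rightarrow> 'q \<Rightarrow> 'w \<Rightarrow> real ^ 'n \<Rightarrow> real"
    and G :: "nat \<Rightarrow> 'q \<Rightarrow> 'w \<Rightarrow> real ^ 'n"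
    and H :: "nat \<Rightarrow> 'q \<Rightarrow> 'w \<Rightarrow> real ^ 'n ^ 'n"
    and c\<^sub>f c\<^sub>g c\<^sub>h c\<^sub>b c\<^sub>a L c\<^sub>e c\<^sub>\<Phi> :: real
    and k :: nat and v :: 'w
    and x\<^sub>k :: "real ^ 'n" and \<delta>\<^sub>k :: real
    and f\<^sub>k m\<^sub>k :: "'q \<Rightarrow> real ^ 'n \<Rightarrow> real"
  assumes data: "trust_region_data M X \<Delta> F G H"
    and f_smooth: "\<And>i. C2_fun (f i)"
    and f_bdd: "\<And>i. bdd_below (range (f i))"
    and const_hb: "c\<^sub>h > 0" "c\<^sub>b > 0"
    and f_hess: "\<And>i x. mat_norm (hessian (f i) x) \<le> c\<^sub>h"
    and beta: "\<And>j \<omega>. \<omega> \<in> space M \<Longrightarrow> hess_bound (\<lambda>i. H j i \<omega>) \<le> c\<^sub>b"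
    and const_La: "L > 0" "c\<^sub>a > 0"
    and F_C1: "\<And>j i \<omega>. \<omega> \<in> space M \<Longrightarrow> C1_fun (F j i \<omega>)"
    and F_Lip: "\<And>j i \<omega>. \<omega> \<in> space M \<Longrightarrow> L-lipschitz_on UNIV (gradient (F j i \<omega>))"
    and F_G: "\<And>j i \<omega>. \<omega> \<in> space M \<Longrightarrow>
                norm (gradient (F j i \<omega>) (X j \<omega>) - G j i \<omega>) \<le> c\<^sub>a * \<Delta> j \<omega>"
    and const_fg: "c\<^sub>f > 0" "c\<^sub>g > 0"
    and v: "v \<in> space M"
    and x\<^sub>k: "x\<^sub>k = X k v" and \<delta>\<^sub>k: "\<delta>\<^sub>k = \<Delta> k v"
    and f\<^sub>k: "\<And>i. f\<^sub>k i = F k i v"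
    and m\<^sub>k: "\<And>i. m\<^sub>k i = random_model X F G H k i v"
    and fl: "\<And>i. fully_linear c\<^sub>f c\<^sub>g (m\<^sub>k i) (f i) x\<^sub>k \<delta>\<^sub>k"
    and c\<^sub>e: "c\<^sub>e = c\<^sub>f + L + c\<^sub>g + c\<^sub>a + c\<^sub>h / 2"
    and c\<^sub>\<Phi>: "c\<^sub>\<Phi> = max c\<^sub>f c\<^sub>e"
  shows "\<forall>d \<in> cball 0 \<delta>\<^sub>k.
           \<bar>max_fun f (x\<^sub>k + d) - max_fun m\<^sub>k d\<bar> \<le> c\<^sub>f * \<delta>\<^sub>k\<^sup>2 \<and>
           \<bar>max_fun f\<^sub>k (x\<^sub>k + d) - max_fun f (x\<^sub>k + d)\<bar> \<le> c\<^sub>e * \<delta>\<^sub>k\<^sup>2 \<and>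
           \<bar>max_fun f\<^sub>k (x\<^sub>k + d) - max_fun m\<^sub>k d\<bar> \<le> c\<^sub>\<Phi> * \<delta>\<^sub>k\<^sup>2"
proof
  fix d :: "real ^ 'n"
  assume d_in: "d \<in> cball 0 \<delta>\<^sub>k"
  then have d: "norm d \<le> \<delta>\<^sub>k"
    by simp
  have m: "m\<^sub>k i = quad_model (f\<^sub>k i) (G k i v) (H k i v) x\<^sub>k" for i
    by (simp add: m\<^sub>k f\<^sub>k x\<^sub>k random_model_def)
  \<comment> \<open>The component bounds carry \<open>L / 2\<close> where \<open>c\<^sub>e\<close>
    has \<open>L\<close>, and the second also lacks \<open>c\<^sub>f\<close>; both are relaxed to
    the stated constants.\<close>
  have mono: "(c\<^sub>f + L / 2 + c\<^sub>g + c\<^sub>a + c\<^sub>h / 2) * \<delta>\<^sub>k\<^sup>2 \<le> c\<^sub>e * \<delta>\<^sub>k\<^sup>2"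
    "(L / 2 + c\<^sub>g + c\<^sub>a + c\<^sub>h / 2) * \<delta>\<^sub>k\<^sup>2 \<le> c\<^sub>\<Phi> * \<delta>\<^sub>k\<^sup>2"
    using const_La const_fg by (auto simp: c\<^sub>e c\<^sub>\<Phi> intro!: mult_right_mono)
  have bounds: "\<bar>f\<^sub>k i (x\<^sub>k + d) - f i (x\<^sub>k + d)\<bar> \<le> (c\<^sub>f + L / 2 + c\<^sub>g + c\<^sub>a + c\<^sub>h / 2) * \<delta>\<^sub>k\<^sup>2"
    "\<bar>f\<^sub>k i (x\<^sub>k + d) - m\<^sub>k i d\<bar> \<le> (L / 2 + c\<^sub>g + c\<^sub>a + c\<^sub>h / 2) * \<delta>\<^sub>k\<^sup>2" for i
  proof -
    have F: "f\<^sub>k i differentiable_on UNIV" "L-lipschitz_on UNIV (gradient (f\<^sub>k i))"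
      "norm (gradient (f\<^sub>k i) x\<^sub>k - G k i v) \<le> c\<^sub>a * \<delta>\<^sub>k"
      using F_C1[OF v, of k i] F_Lip[OF v, of k i] F_G[OF v, of k i]
      by (auto simp: C1_fun_def f\<^sub>k x\<^sub>k \<delta>\<^sub>k)
    have f: "f i differentiable_on UNIV" "c\<^sub>h-lipschitz_on UNIV (gradient (f i))"
      using f_smooth[of i] C2_fun_gradient_lipschitz[OF f_smooth f_hess, of i]
      by (auto simp: C2_fun_def)
    show "\<bar>f\<^sub>k i (x\<^sub>k + d) - f i (x\<^sub>k + d)\<bar> \<le> (c\<^sub>f + L / 2 + c\<^sub>g + c\<^sub>a + c\<^sub>h / 2) * \<delta>\<^sub>k\<^sup>2"
      "\<bar>f\<^sub>k i (x\<^sub>k + d) - m\<^sub>k i d\<bar> \<le> (L / 2 + c\<^sub>g + c\<^sub>a + c\<^sub>h / 2) * \<delta>\<^sub>k\<^sup>2"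
      using fully_linear_component_bounds[OF F(1,2) f F(3) _ d] fl[of i] by (simp_all add: m)
  qed
  \<comment> \<open>The value part of full linearity, taken componentwise, is already this
    bound.\<close>
  have "\<bar>max_fun f (x\<^sub>k + d) - max_fun m\<^sub>k d\<bar> \<le> c\<^sub>f * \<delta>\<^sub>k\<^sup>2"
    using fl d_in by (intro max_fun_diff_le) (auto simp: fully_linear_def)
  moreover have "\<bar>max_fun f\<^sub>k (x\<^sub>k + d) - max_fun f (x\<^sub>k + d)\<bar> \<le> c\<^sub>e * \<delta>\<^sub>k\<^sup>2"
    using bounds(1) mono(1) by (intro max_fun_diff_le) (rule order_trans)
  moreover have "\<bar>max_fun f\<^sub>k (x\<^sub>k + d) - max_fun m\<^sub>k d\<bar> \<le> c\<^sub>\<Phi> * \<delta>\<^sub>k\<^sup>2"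
    using bounds(2) mono(2) by (intro max_fun_diff_le) (rule order_trans)
  ultimately show "\<bar>max_fun f (x\<^sub>k + d) - max_fun m\<^sub>k d\<bar> \<le> c\<^sub>f * \<delta>\<^sub>k\<^sup>2 \<and>
      \<bar>max_fun f\<^sub>k (x\<^sub>k + d) - max_fun f (x\<^sub>k + d)\<bar> \<le> c\<^sub>e * \<delta>\<^sub>k\<^sup>2 \<and>
      \<bar>max_fun f\<^sub>k (x\<^sub>k + d) - max_fun m\<^sub>k d\<bar> \<le> c\<^sub>\<Phi> * \<delta>\<^sub>k\<^sup>2"
    by blast
qed

end
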